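(* Let $\alpha$ be irrational with regular continued fraction expansion $\alpha=[a_0;a_1,a_2,\dots]$, and suppose $R:=\liminf_{i\to\infty}a_i$ satisfies $2\le R<\infty$. With $\gamma_{**}$, $R_*$, $\theta_1$ as in the context, $$M(\alpha,\gamma_{**})\ \ge\ \frac14\left(1-\frac{2}{R_*}\right)\left(1-2\theta_1^2-\theta_1^3\right)\ \ge\ \frac14\left(1-\frac{2}{R_*}-\frac{2}{R_*^2}+\frac{3}{R_*^3}\right).$$
   Context: For real $x$, $\|x\|$ is the distance to the nearest integer. $M(\alpha,\gamma):=\liminf_{|n|\to\infty}|n|\,\|n\alpha-\gamma\|$ ($n\in\mathbb Z$). Regular continued fraction: $a_0=\lfloor\alpha\rfloor$, $a_i\ge1$, $\alpha=a_0+\cfrac{1}{a_1+\cfrac{1}{a_2+\cdots}}$; convergents $p_{-1}=1,q_{-1}=0,p_0=a_0,q_0=1$, $p_i=a_ip_{i-1}+p_{i-2}$, $q_i=a_iq_{i-1}+q_{i-2}$; $D_i:=|q_i\alpha-p_i|$. Let $\lambda_i'=0$ if $a_i$ is even and $\lambda_i'=1$ if $a_i$ is odd, and $\gamma_{**}:=\sum_{i\ge1}\tfrac12(a_i+\lambda_i')D_{i-1}$. $R_*:=R$ if $R$ is odd, $R+1$ if $R$ is even; $\theta_1:=\tfrac12(\sqrt{R_*^2+4}-R_* )$. *)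

theory Defs
  imports "HOL-Analysis.Analysis"
begin

definition dist_nearest_int :: "real \<Rightarrow> real" where
  "dist_nearest_int x = \<bar>x - of_int (round x)\<bar>"

text \<open>The filter \<open>filtercomap abs at_top\<close> on the integers expresses \<open>\<bar>n\<bar> \<rightarrow> \<infinity>\<close>,
  so positive and negative \<open>n\<close> are both taken into account.\<close>

definition inhom_const :: "real \<Rightarrow> real \<Rightarrow> ereal" where
  "inhom_const \<alpha> \<gamma> =
     Liminf (filtercomap (\<lambda>n::int. \<bar>n\<bar>) at_top)
       (\<lambda>n. ereal (of_int \<bar>n\<bar> * dist_nearest_int (of_int n * \<alpha> - \<gamma>)))"

text \<open>\<open>cf_trunc a n\<close> is the value of the finite continued fraction \<open>[a 0; a 1, \<dots>, a n]\<close>.\<close>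

primrec cf_trunc :: "(nat \<Rightarrow> int) \<Rightarrow> nat \<Rightarrow> real" where
  "cf_trunc a 0 = of_int (a 0)"
| "cf_trunc a (Suc n) = of_int (a 0) + 1 / cf_trunc (\<lambda>i. a (Suc i)) n"

definition regular_cf_expansion :: "(nat \<Rightarrow> int) \<Rightarrow> real \<Rightarrow> bool" where
  "regular_cf_expansion a \<alpha> \<longleftrightarrow>
     a 0 = \<lfloor>\<alpha>\<rfloor> \<and> (\<forall>i\<ge>1. a i \<ge> 1) \<and> cf_trunc a \<longlonglongrightarrow> \<alpha>"

text \<open>The equations at index \<open>1\<close> are the general recurrence with
  \<open>p\<close>, \<open>q\<close> at index \<open>-1\<close> equal to \<open>1\<close> and \<open>0\<close>, respectively.\<close>

fun cf_p :: "(nat \<Rightarrow> int) \<Rightarrow> nat \<Rightarrow> int" where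
  "cf_p a 0 = a 0"
| "cf_p a (Suc 0) = a 1 * a 0 + 1"
| "cf_p a (Suc (Suc i)) = a (Suc (Suc i)) * cf_p a (Suc i) + cf_p a i"

fun cf_q :: "(nat \<Rightarrow> int) \<Rightarrow> nat \<Rightarrow> int" where
  "cf_q a 0 = 1"
| "cf_q a (Suc 0) = a 1 * 1 + 0"
| "cf_q a (Suc (Suc i)) = a (Suc (Suc i)) * cf_q a (Suc i) + cf_q a i"

definition cf_D :: "(nat \<Rightarrow> int) \<Rightarrow> real \<Rightarrow> nat \<Rightarrow> real" where
  "cf_D a \<alpha> i = \<bar>of_int (cf_q a i) * \<alpha> - of_int (cf_p a i)\<bar>"

definition parity_corr :: "(nat \<Rightarrow> int) \<Rightarrow> nat \<Rightarrow> int" where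
  "parity_corr a i = (if even (a i) then 0 else 1)"

text \<open>The sum over \<open>i \<ge> 1\<close> is reindexed by \<open>i = Suc j\<close>.\<close>

definition gamma_ss :: "(nat \<Rightarrow> int) \<Rightarrow> real \<Rightarrow> real" where
  "gamma_ss a \<alpha> =
     (\<Sum>j. 1/2 * of_int (a (Suc j) + parity_corr a (Suc j)) * cf_D a \<alpha> j)"

definition R_star :: "int \<Rightarrow> int" where
  "R_star R = (if odd R then R else R + 1)"

definition theta1 :: "int \<Rightarrow> real" where
  "theta1 R = 1/2 * (sqrt (of_int (R_star R) ^ 2 + 4) - of_int (R_star R))"

end

theory Submission
  imports Defs
begin

text \<open>
  The points \<open>(n, n\<alpha> - m - \<gamma>\<^sub>*\<^sub>*)\<close> form a translate of a planar lattice, of which consecutive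
  convergents are a basis. Since \<open>\<Sum> a\<^sub>i D\<^sub>i\<^sub>-\<^sub>1 = 1 + D\<^sub>0\<close> telescopes, twice a point is a
  combination of two consecutive convergents with odd coefficients, up to corrections
  \<open>\<sigma>\<close> and \<open>\<tau>\<close> that only involve the \<open>\<lambda>'\<^sub>i\<close>. The points with coefficients \<open>\<plusminus>1\<close> are the
  vertices of a cell, one in each quadrant. For large \<open>\<bar>n\<bar>\<close>, either the second coordinate is
  bounded away from \<open>0\<close>, or the product of the coefficients changes sign between two consecutive
  cells. At that change \<open>n (n\<alpha> - m - \<gamma>\<^sub>*\<^sub>*)\<close> is, up to sign, a concave function of one coefficient,
  hence at least its value at a vertex of one of the two cells.

  Odd partial quotients are eventually at least \<open>r = R\<^sub>*\<close>, even ones at least \<open>r - 1\<close>. In terms of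
  \<open>\<phi> = q\<^sub>k\<^sub>-\<^sub>1 / q\<^sub>k\<close>, \<open>\<psi> = D\<^sub>k / D\<^sub>k\<^sub>-\<^sub>1\<close>, \<open>s = \<sigma>\<^sub>k / q\<^sub>k\<close>, \<open>T = \<tau>\<^sub>k / D\<^sub>k\<^sub>-\<^sub>1\<close> the vertices
  have the values \<open>(1 + \<phi> \<plusminus> s) (1 - \<psi> \<mp> T) / (1 + \<phi> \<psi>)\<close> and \<open>(1 - \<phi> \<mp> s) (1 + \<psi> \<mp> T) / (1 + \<phi> \<psi>)\<close>.
  The constant comes from \<open>(1 - \<phi> - s) (1 + \<psi> - T)\<close>, where the extremal tail has all partial
  quotients equal to \<open>r\<close>.
\<close>

section \<open>Limits and concave products\<close>

lemma inhom_const_ge: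
  assumes "\<And>n m :: int. N \<le> \<bar>n\<bar> \<Longrightarrow> b \<le> of_int \<bar>n\<bar> * \<bar>of_int n * \<alpha> - of_int m - \<gamma>\<bar>"
  shows "ereal b \<le> inhom_const \<alpha> \<gamma>"
  unfolding inhom_const_def
proof (rule Liminf_bounded)
  have "\<forall>\<^sub>F k :: int in at_top. N \<le> k" by (rule eventually_ge_at_top)
  then have "\<forall>\<^sub>F n :: int in filtercomap abs at_top. N \<le> \<bar>n\<bar>" by (rule eventually_filtercomapI)
  then show "\<forall>\<^sub>F n :: int in filtercomap abs at_top.
      ereal b \<le> ereal (of_int \<bar>n\<bar> * dist_nearest_int (of_int n * \<alpha> - \<gamma>))"
    by eventually_elim (use assms in \<open>simp add: dist_nearest_int_def algebra_simps\<close>)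
qed

lemma eventually_ge_of_Liminf_ge:
  fixes f :: "'a \<Rightarrow> int"
  assumes "ereal (of_int b) \<le> Liminf F (\<lambda>x. ereal (of_int (f x)))"
  shows "\<forall>\<^sub>F x in F. b \<le> f x"
proof -
  have "ereal (of_int b - 1) < ereal (of_int b)" by simp
  then have "ereal (of_int b - 1) < Liminf F (\<lambda>x. ereal (of_int (f x)))"
    using assms by (rule less_le_trans)
  then have "\<forall>\<^sub>F x in F. ereal (of_int b - 1) < ereal (of_int (f x))" by (rule less_LiminfD)
  then show ?thesis
  proof eventually_elim
    case (elim x)
    then have "real_of_int (b - 1) < of_int (f x)" by simp
    then show ?case unfolding of_int_less_iff by simp
  qed
qed

lemma eventually_Suc_step:
  assumes "\<forall>\<^sub>F k in sequentially. P k" and "\<And>k. K \<le> k \<Longrightarrow> P k \<Longrightarrow> Q (Suc k)"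
  shows "\<forall>\<^sub>F k in sequentially. Q k"
proof -
  from assms(1) have "\<forall>\<^sub>F k in sequentially. Q (Suc k)"
    using eventually_ge_at_top[of K] by eventually_elim (use assms(2) in auto)
  then show ?thesis by (simp add: eventually_sequentially_Suc)
qed

lemma concave_product_ge_on_closed_segment:
  fixes u v p d b x lo hi :: real
  assumes "p * d \<le> 0" and "x \<in> closed_segment lo hi"
    and lo: "b \<le> (u + lo * p) * (v + lo * d)" and hi: "b \<le> (u + hi * p) * (v + hi * d)"
  shows "b \<le> (u + x * p) * (v + x * d)"
proof -
  let ?f = "\<lambda>x. (u + x * p) * (v + x * d)"
  obtain w where w: "0 \<le> w" "w \<le> 1" and x: "x = (1 - w) * lo + w * hi"
    using assms(2) by (auto simp: in_segment)
  have "b = (1 - w) * b + w * b" by (simp add: algebra_simps)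
  also have "\<dots> \<le> (1 - w) * ?f lo + w * ?f hi"
    using w lo hi by (intro add_mono mult_left_mono) auto
  also have "\<dots> \<le> (1 - w) * ?f lo + w * ?f hi - w * (1 - w) * (hi - lo)^2 * (p * d)"
    using w assms(1) by (simp add: mult_nonneg_nonpos)
  also have "\<dots> = ?f x" unfolding x by (simp add: algebra_simps power2_eq_square)
  finally show ?thesis .
qed

lemma le_mult_of_factors_le:
  fixes b m n y z :: real
  assumes "0 < b" "b \<le> m * y" "0 \<le> m" "m \<le> n" "y \<le> z"
  shows "b \<le> n * z"
proof -
  have "0 < m * y" using assms by linarith
  then have "0 < y" using assms(3) by (simp add: zero_less_mult_iff)
  then have "m * y \<le> n * z" using assms by (intro mult_mono) auto
  then show ?thesis using assms(2) by linarith
qed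

lemma of_int_sgn_mult:
  fixes u v :: int
  assumes "u \<noteq> 0"
  shows "of_int (sgn u) \<in> {1, -1 :: real}"
    and "1 \<le> of_int (sgn u) * (of_int u :: real)"
    and "0 < u * v \<Longrightarrow> 1 \<le> of_int (sgn u) * (of_int v :: real)"
    and "u * v < 0 \<Longrightarrow> of_int (sgn u) * (of_int v :: real) \<le> -1"
  using assms by (auto simp: sgn_if zero_less_mult_iff mult_less_0_iff)

section \<open>Continued fractions of irrational numbers\<close>

lemma cf_trunc_ge:
  assumes "\<And>i. i \<ge> 1 \<Longrightarrow> a i \<ge> 1"
  shows "real_of_int (a 0) \<le> cf_trunc a n"
  using assms
proof (induction n arbitrary: a)
  case (Suc n)
  have "real_of_int (a 1) \<le> cf_trunc (\<lambda>i. a (Suc i)) n"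
    using Suc.IH[of "\<lambda>i. a (Suc i)"] Suc.prems by simp
  moreover have "1 \<le> real_of_int (a 1)" using Suc.prems[of 1] by simp
  ultimately show ?case by simp
qed simp

locale irrational_cf =
  fixes \<alpha> :: real and a :: "nat \<Rightarrow> int"
  assumes irrational: "\<alpha> \<notin> \<rat>" and expansion: "regular_cf_expansion a \<alpha>"
begin

primrec complete_quotient :: "nat \<Rightarrow> real" where
  "complete_quotient 0 = \<alpha>"
| "complete_quotient (Suc n) = 1 / (complete_quotient n - of_int (a n))"

abbreviation A :: "nat \<Rightarrow> real" where "A i \<equiv> real_of_int (a i)"
abbreviation p :: "nat \<Rightarrow> real" where "p i \<equiv> real_of_int (cf_p a i)"
abbreviation q :: "nat \<Rightarrow> real" where "q i \<equiv> real_of_int (cf_q a i)"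
abbreviation D :: "nat \<Rightarrow> real" where "D \<equiv> cf_D a \<alpha>"
abbreviation parity :: "nat \<Rightarrow> real" where "parity i \<equiv> real_of_int (parity_corr a i)"

lemma partial_quotient_ge_1: "i \<ge> 1 \<Longrightarrow> A i \<ge> 1"
  using expansion by (auto simp: regular_cf_expansion_def)

lemma parity_bounds: "0 \<le> parity i" "parity i \<le> 1"
  by (auto simp: parity_corr_def)

lemma complete_quotient_irrational: "complete_quotient m \<notin> \<rat>"
proof (induction m)
  case 0
  then show ?case using irrational by simp
next
  case (Suc m)
  then have "complete_quotient m - A m \<notin> \<rat>" by (metis Rats_add Rats_of_int diff_add_cancel)
  then show ?case
    by (metis Rats_inverse complete_quotient.simps(2) inverse_eq_divide inverse_inverse_eq)
qed

lemma complete_quotient_neq: "complete_quotient m \<noteq> A m"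
  using complete_quotient_irrational[of m] by (metis Rats_of_int)

lemma complete_quotient_limit: "cf_trunc (\<lambda>i. a (i + m)) \<longlonglongrightarrow> complete_quotient m"
proof (induction m)
  case 0
  then show ?case using expansion by (simp add: regular_cf_expansion_def)
next
  case (Suc m)
  have "(\<lambda>n. 1 / (cf_trunc (\<lambda>i. a (i + m)) (Suc n) - A m)) \<longlonglongrightarrow> 1 / (complete_quotient m - A m)"
    using Suc.IH complete_quotient_neq by (intro tendsto_intros LIMSEQ_Suc) auto
  then show ?case by simp
qed

lemma complete_quotient_gt: "A m < complete_quotient m"
proof -
  have "A m \<le> complete_quotient m"
  proof (cases m)
    case 0
    then show ?thesis using expansion by (simp add: regular_cf_expansion_def)
  next
    case (Suc k)
    have "\<forall>n. A m \<le> cf_trunc (\<lambda>i. a (i + m)) n"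
      using cf_trunc_ge[of "\<lambda>i. a (i + m)"] partial_quotient_ge_1 by simp
    then show ?thesis using complete_quotient_limit[of m] by (meson Lim_bounded2)
  qed
  then show ?thesis using complete_quotient_neq[of m] by simp
qed

lemma complete_quotient_gt_1: "1 < complete_quotient (Suc m)"
  using complete_quotient_gt[of "Suc m"] partial_quotient_ge_1[of "Suc m"] by simp

definition signed_error :: "nat \<Rightarrow> real" where
  "signed_error i = (-1)^i * (q i * \<alpha> - p i)"

lemma signed_error_simps:
  "signed_error 0 = \<alpha> - A 0"
  "signed_error (Suc 0) = 1 - A 1 * (\<alpha> - A 0)"
  "signed_error (Suc (Suc i)) = signed_error i - A (Suc (Suc i)) * signed_error (Suc i)"
  by (simp_all add: signed_error_def algebra_simps)

lemma signed_error_eq_mult: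
  "signed_error i = complete_quotient (Suc (Suc i)) * signed_error (Suc i)"
proof (induction i)
  case 0
  define x where "x = \<alpha> - A 0"
  have "x \<noteq> 0" "1 / x \<noteq> A 1"
    using complete_quotient_neq[of 0] complete_quotient_neq[of 1] by (auto simp: x_def)
  then have "x = 1 / (1 / x - A 1) * (1 - A 1 * x)" by (simp add: field_simps)
  then show ?case by (simp add: signed_error_simps x_def)
next
  case (Suc i)
  define e where "e = signed_error (Suc i)"
  define x where "x = complete_quotient (Suc (Suc i)) - A (Suc (Suc i))"
  have "x \<noteq> 0" using complete_quotient_neq[of "Suc (Suc i)"] by (simp add: x_def)
  moreover have "signed_error (Suc (Suc i)) = x * e"
    using Suc.IH by (simp add: signed_error_simps x_def e_def algebra_simps)
  ultimately have "e = 1 / x * signed_error (Suc (Suc i))" by simp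
  then show ?case unfolding e_def x_def complete_quotient.simps(2)[of "Suc (Suc i)"] .
qed

lemma signed_error_pos: "0 < signed_error i"
proof (induction i)
  case 0
  then show ?case using complete_quotient_gt[of 0] by (simp add: signed_error_simps)
next
  case (Suc i)
  have "0 < complete_quotient (Suc (Suc i))" using complete_quotient_gt_1[of "Suc i"] by linarith
  then show ?case using Suc.IH signed_error_eq_mult[of i] by (metis zero_less_mult_pos)
qed

lemma D_eq_signed_error: "D i = signed_error i"
proof -
  have "D i = \<bar>signed_error i\<bar>" by (simp add: cf_D_def signed_error_def abs_mult power_abs)
  then show ?thesis using signed_error_pos[of i] by simp
qed

lemma D_pos: "0 < D i"
  by (simp add: D_eq_signed_error signed_error_pos)

lemma D_simps:
  "D 0 = \<alpha> - A 0"
  "D (Suc 0) = 1 - A 1 * D 0"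
  "D (Suc (Suc i)) = D i - A (Suc (Suc i)) * D (Suc i)"
  by (simp_all add: D_eq_signed_error signed_error_simps)

lemma q_ge_1: "1 \<le> q i"
proof -
  have "1 \<le> cf_q a i"
    using expansion
  proof (induction i rule: induct_nat_012)
    case (ge2 n)
    then have "1 \<le> a (Suc (Suc n))" by (auto simp: regular_cf_expansion_def)
    then have "1 * 1 \<le> a (Suc (Suc n)) * cf_q a (Suc n)" using ge2 by (intro mult_mono) auto
    then show ?case using ge2 by simp
  qed (auto simp: regular_cf_expansion_def)
  then show ?thesis by simp
qed

lemma q_pos: "0 < q i"
  using q_ge_1[of i] by linarith

lemma q_ge_index: "real i \<le> q i"
proof (induction i rule: induct_nat_012)
  case 1
  then show ?case using q_ge_1[of 1] by simp
next
  case (ge2 n)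
  have "1 * q (Suc n) \<le> A (Suc (Suc n)) * q (Suc n)"
    using partial_quotient_ge_1 q_pos[of "Suc n"] by (intro mult_right_mono) auto
  then have "real (Suc n) + 1 \<le> A (Suc (Suc n)) * q (Suc n) + q n"
    using ge2 q_ge_1[of n] by linarith
  then show ?case by simp
qed simp

lemma q_D_determinant: "q (Suc i) * D i + q i * D (Suc i) = 1"
proof (induction i)
  case 0
  then show ?case by (simp add: D_simps)
next
  case (Suc i)
  then show ?case by (simp add: D_simps algebra_simps)
qed

lemma D_le_inverse_Suc: "D i \<le> inverse (real (Suc i))"
proof -
  have "real (Suc i) * D i \<le> q (Suc i) * D i"
    using q_ge_index[of "Suc i"] D_pos[of i] by (intro mult_right_mono) auto
  also have "\<dots> \<le> 1"
    using q_D_determinant[of i] mult_pos_pos[OF q_pos[of i] D_pos[of "Suc i"]] by linarith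
  finally show ?thesis by (simp add: field_simps)
qed

lemma D_tendsto_0: "D \<longlonglongrightarrow> 0"
proof (rule tendsto_sandwich[OF _ _ tendsto_const LIMSEQ_inverse_real_of_nat])
  show "\<forall>\<^sub>F n in sequentially. 0 \<le> D n" using D_pos by (simp add: less_imp_le)
  show "\<forall>\<^sub>F n in sequentially. D n \<le> inverse (real (Suc n))"
    using D_le_inverse_Suc by (intro always_eventually allI)
qed

lemma partial_quotient_D_sums: "(\<lambda>j. A (Suc j) * D j) sums (1 + D 0)"
proof -
  define d where "d j = (case j of 0 \<Rightarrow> 1 | Suc i \<Rightarrow> D i)" for j
  have "A (Suc j) * D j = d j - d (Suc (Suc j))" for j
    by (cases j) (simp_all add: d_def D_simps)
  then have telescope: "A (Suc j) * D j = (d j + d (Suc j)) - (d (Suc j) + d (Suc (Suc j)))" for j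
    by simp
  have "d \<longlonglongrightarrow> 0"
    using D_tendsto_0 by (subst filterlim_sequentially_Suc[symmetric]) (simp add: d_def)
  then have "(\<lambda>j. d j + d (Suc j)) \<longlonglongrightarrow> 0 + 0" by (intro tendsto_add LIMSEQ_Suc)
  from telescope_sums'[OF this] show ?thesis
    unfolding telescope by (simp add: d_def)
qed

subsection \<open>The corrections \<open>\<sigma>\<close> and \<open>\<tau>\<close>\<close>

definition tau :: "nat \<Rightarrow> real" where
  "tau k = (\<Sum>j. parity (Suc (j + k)) * D (j + k))"

primrec sigma :: "nat \<Rightarrow> real" where
  "sigma 0 = -1"
| "sigma (Suc k) = parity (Suc k) * q k - sigma k"

lemma tau_summable: "summable (\<lambda>j. parity (Suc (j + k)) * D (j + k))"
proof -
  have "summable (\<lambda>j. parity (Suc j) * D j)"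
  proof (rule summable_comparison_test')
    show "summable (\<lambda>j. A (Suc j) * D j)" using partial_quotient_D_sums by (rule sums_summable)
    show "norm (parity (Suc j) * D j) \<le> A (Suc j) * D j" for j
      using parity_bounds[of "Suc j"] partial_quotient_ge_1[of "Suc j"] D_pos[of j]
      by (auto simp: abs_mult intro!: mult_right_mono)
  qed
  from summable_ignore_initial_segment[OF this, of k] show ?thesis by simp
qed

lemma tau_rec: "tau k = parity (Suc k) * D k + tau (Suc k)"
  unfolding tau_def using suminf_split_head[OF tau_summable[of k]] by simp

lemma tau_nonneg: "0 \<le> tau k"
  unfolding tau_def using parity_bounds D_pos
  by (intro suminf_nonneg tau_summable) (simp add: less_imp_le)

lemma gamma_ss_eq_tau: "2 * gamma_ss a \<alpha> = 1 + D 0 + tau 0"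
proof -
  have "(\<lambda>j. parity (Suc j) * D j) sums tau 0"
    using tau_summable[of 0] by (simp add: tau_def summable_sums)
  from sums_mult[OF sums_add[OF partial_quotient_D_sums this], of "1/2"]
  have "(\<lambda>j. 1/2 * of_int (a (Suc j) + parity_corr a (Suc j)) * D j) sums (1/2 * (1 + D 0 + tau 0))"
    by (simp add: algebra_simps)
  then show ?thesis unfolding gamma_ss_def by (simp add: sums_iff)
qed

section \<open>Grid points and cells\<close>

text \<open>If \<open>u\<close> and \<open>- v\<close> are the odd coefficients of a grid point with respect to the convergents
  \<open>k\<close> and \<open>k + 1\<close>, these are \<open>2 n\<close>, up to the sign \<open>(-1)^k\<close>, and \<open>2 (n\<alpha> - m - \<gamma>\<^sub>*\<^sub>*)\<close>.\<close>

definition grid_n :: "nat \<Rightarrow> real \<Rightarrow> real \<Rightarrow> real" where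
  "grid_n k u v = u * q k - v * q (Suc k) + sigma (Suc k)"

definition grid_y :: "nat \<Rightarrow> real \<Rightarrow> real \<Rightarrow> real" where
  "grid_y k u v = u * D k + v * D (Suc k) - tau (Suc k)"

lemma
  assumes "w = A (Suc (Suc k)) * u + v - parity (Suc (Suc k))"
  shows grid_n_Suc: "grid_n (Suc k) w u = - grid_n k u v"
    and grid_y_Suc: "grid_y (Suc k) w u = grid_y k u v"
  unfolding assms grid_n_def grid_y_def sigma.simps(2)[of "Suc k"] tau_rec[of "Suc k"]
  by (simp_all add: D_simps algebra_simps)

text \<open>The equation at index \<open>1\<close> is the general recurrence with the value \<open>2 n - 1\<close> at index \<open>-1\<close>.\<close>

fun coord :: "int \<Rightarrow> int \<Rightarrow> nat \<Rightarrow> int" where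
  "coord n m 0 = 2 * n * a 0 - 2 * m - 1"
| "coord n m (Suc 0) = a 1 * coord n m 0 + 2 * n - 1 - parity_corr a 1"
| "coord n m (Suc (Suc k)) =
     a (Suc (Suc k)) * coord n m (Suc k) + coord n m k - parity_corr a (Suc (Suc k))"

lemma odd_coord: "odd (coord n m k)"
  by (induction k rule: induct_nat_012) (auto simp: parity_corr_def)

lemma coord_nonzero: "coord n m k \<noteq> 0"
  using odd_coord[of n m k] by auto

lemma real_coord_Suc_Suc:
  "real_of_int (coord n m (Suc (Suc k))) =
     A (Suc (Suc k)) * of_int (coord n m (Suc k)) + of_int (coord n m k) - parity (Suc (Suc k))"
  by simp

lemma grid_n_coord:
  "grid_n k (of_int (coord n m (Suc k))) (of_int (coord n m k)) = (-1)^k * (2 * of_int n)"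
proof (induction k)
  case 0
  then show ?case by (simp add: grid_n_def algebra_simps)
next
  case (Suc k)
  then show ?case using grid_n_Suc[OF real_coord_Suc_Suc] by simp
qed

lemma grid_y_coord:
  "grid_y k (of_int (coord n m (Suc k))) (of_int (coord n m k)) =
     2 * (of_int n * \<alpha> - of_int m - gamma_ss a \<alpha>)"
proof (induction k)
  case 0
  have "2 * gamma_ss a \<alpha> = 1 + D 0 + parity 1 * D 0 + tau 1"
    using gamma_ss_eq_tau tau_rec[of 0] by simp
  moreover have "of_int n * \<alpha> = of_int n * A 0 + of_int n * D 0"
    by (simp add: D_simps algebra_simps)
  ultimately show ?case by (simp add: grid_y_def D_simps algebra_simps)
next
  case (Suc k)
  then show ?case using grid_y_Suc[OF real_coord_Suc_Suc] by simp
qed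

text \<open>\<open>b\<close> bounds \<open>4 \<bar>n\<bar> \<bar>n\<alpha> - m - \<gamma>\<^sub>*\<^sub>*\<bar>\<close> from below at the four vertices \<open>(\<delta>, -\<delta>)\<close> and \<open>(\<delta>, \<delta>)\<close>; the
  products there are positive and negative, respectively.\<close>

definition cell_ge :: "real \<Rightarrow> nat \<Rightarrow> bool" where
  "cell_ge b k \<longleftrightarrow> (\<forall>\<delta>\<in>{1, -1}.
     q k \<le> \<delta> * grid_n k \<delta> (-\<delta>) \<and> b \<le> grid_n k \<delta> (-\<delta>) * grid_y k \<delta> (-\<delta>) \<and>
     \<delta> * grid_n k \<delta> \<delta> \<le> 0 \<and> b \<le> - (grid_n k \<delta> \<delta> * grid_y k \<delta> \<delta>))"

lemma opposite_signs_grid_n_ge: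
  assumes "cell_ge b k" "\<delta> \<in> {1, -1}" "1 \<le> \<delta> * u" "\<delta> * v \<le> -1"
  shows "q k \<le> \<bar>grid_n k u v\<bar>"
proof -
  have "q k \<le> \<delta> * grid_n k \<delta> (-\<delta>)" using assms(1,2) unfolding cell_ge_def by blast
  also have "\<dots> = 1 * q k + 1 * q (Suc k) + \<delta> * sigma (Suc k)"
    using assms(2) by (auto simp: grid_n_def algebra_simps)
  also have "\<dots> \<le> (\<delta> * u) * q k + (- (\<delta> * v)) * q (Suc k) + \<delta> * sigma (Suc k)"
    using assms(3,4) q_pos[of k] q_pos[of "Suc k"]
    by (intro add_mono mult_right_mono order_refl) auto
  also have "\<dots> = \<delta> * grid_n k u v" by (simp add: grid_n_def algebra_simps)
  also have "\<dots> \<le> \<bar>grid_n k u v\<bar>" using assms(2) by auto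
  finally show ?thesis .
qed

lemma same_signs_grid_y_ge:
  assumes "\<delta> \<in> {1, -1}" "1 \<le> \<delta> * u" "1 \<le> \<delta> * v"
  shows "grid_y k 1 1 \<le> \<bar>grid_y k u v\<bar>"
proof -
  have "grid_y k 1 1 = 1 * D k + 1 * D (Suc k) - tau (Suc k)" by (simp add: grid_y_def)
  also have "\<dots> \<le> (\<delta> * u) * D k + (\<delta> * v) * D (Suc k) - \<delta> * tau (Suc k)"
    using assms D_pos[of k] D_pos[of "Suc k"] tau_nonneg[of "Suc k"]
    by (intro diff_mono add_mono mult_right_mono) auto
  also have "\<dots> = \<delta> * grid_y k u v" by (simp add: grid_y_def algebra_simps)
  also have "\<dots> \<le> \<bar>grid_y k u v\<bar>" using assms(1) by auto
  finally show ?thesis .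
qed

lemma grid_y_vertex_pos:
  assumes "cell_ge b k" "0 < b"
  shows "0 < grid_y k 1 1"
proof -
  have "grid_n k 1 1 \<le> 0" "b \<le> - (grid_n k 1 1 * grid_y k 1 1)"
    using assms(1) by (auto simp: cell_ge_def)
  then show ?thesis using assms(2) by (smt (verit) mult_nonpos_nonpos)
qed

lemma opposite_signs_edge_ge:
  assumes "cell_ge b k" "0 < b" "\<delta> \<in> {1, -1}" "1 \<le> \<delta> * u"
  shows "b \<le> grid_n k u (-\<delta>) * grid_y k u (-\<delta>)"
proof -
  have vertex: "q k \<le> \<delta> * grid_n k \<delta> (-\<delta>)" "b \<le> grid_n k \<delta> (-\<delta>) * grid_y k \<delta> (-\<delta>)"
    using assms(1,3) unfolding cell_ge_def by blast+
  have "b \<le> (\<delta> * grid_n k u (-\<delta>)) * (\<delta> * grid_y k u (-\<delta>))"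
  proof (rule le_mult_of_factors_le[OF assms(2)])
    show "b \<le> (\<delta> * grid_n k \<delta> (-\<delta>)) * (\<delta> * grid_y k \<delta> (-\<delta>))" using vertex(2) assms(3) by auto
    show "0 \<le> \<delta> * grid_n k \<delta> (-\<delta>)" using vertex(1) q_pos[of k] by linarith
    have "1 * q k \<le> (\<delta> * u) * q k" "1 * D k \<le> (\<delta> * u) * D k"
      using assms(4) q_pos[of k] D_pos[of k] by (intro mult_right_mono; simp)+
    then show "\<delta> * grid_n k \<delta> (-\<delta>) \<le> \<delta> * grid_n k u (-\<delta>)"
      and "\<delta> * grid_y k \<delta> (-\<delta>) \<le> \<delta> * grid_y k u (-\<delta>)"
      using assms(3) by (auto simp: grid_n_def grid_y_def)
  qed
  then show ?thesis using assms(3) by auto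
qed

lemma same_signs_edge_ge:
  assumes "cell_ge b k" "0 < b" "\<delta> \<in> {1, -1}" "1 \<le> \<delta> * v"
  shows "b \<le> - (grid_n k \<delta> v * grid_y k \<delta> v)"
proof -
  have vertex: "\<delta> * grid_n k \<delta> \<delta> \<le> 0" "b \<le> - (grid_n k \<delta> \<delta> * grid_y k \<delta> \<delta>)"
    using assms(1,3) unfolding cell_ge_def by blast+
  have "b \<le> (- (\<delta> * grid_n k \<delta> v)) * (\<delta> * grid_y k \<delta> v)"
  proof (rule le_mult_of_factors_le[OF assms(2)])
    show "b \<le> (- (\<delta> * grid_n k \<delta> \<delta>)) * (\<delta> * grid_y k \<delta> \<delta>)" using vertex(2) assms(3) by auto
    show "0 \<le> - (\<delta> * grid_n k \<delta> \<delta>)" using vertex(1) by linarith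
    have "1 * q (Suc k) \<le> (\<delta> * v) * q (Suc k)" "1 * D (Suc k) \<le> (\<delta> * v) * D (Suc k)"
      using assms(4) q_pos[of "Suc k"] D_pos[of "Suc k"] by (intro mult_right_mono; simp)+
    then show "- (\<delta> * grid_n k \<delta> \<delta>) \<le> - (\<delta> * grid_n k \<delta> v)"
      and "\<delta> * grid_y k \<delta> \<delta> \<le> \<delta> * grid_y k \<delta> v"
      using assms(3) by (auto simp: grid_n_def grid_y_def)
  qed
  then show ?thesis using assms(3) by auto
qed

text \<open>For fixed \<open>u\<close>, the coefficient \<open>v\<close> lies between \<open>-\<delta>\<close>, on the edge of the cell \<open>k\<close>, and the
  value for which the coefficient \<open>w\<close> in the next cell is \<open>\<delta>\<close>.\<close>

lemma sign_change_grid_product_ge: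
  assumes cells: "cell_ge b k" "cell_ge b (Suc k)" and b: "0 < b" and \<delta>: "\<delta> \<in> {1, -1}"
    and u: "1 \<le> \<delta> * u" and v: "\<delta> * v \<le> -1"
    and w: "1 \<le> \<delta> * w" "w = A (Suc (Suc k)) * u + v - parity (Suc (Suc k))"
  shows "b \<le> grid_n k u v * grid_y k u v"
proof -
  define v' where "v' = \<delta> - A (Suc (Suc k)) * u + parity (Suc (Suc k))"
  have \<delta>_eq: "\<delta> = A (Suc (Suc k)) * u + v' - parity (Suc (Suc k))" by (simp add: v'_def)
  have segment: "v \<in> closed_segment v' (-\<delta>)"
    using \<delta> v w by (auto simp: v'_def closed_segment_eq_real_ivl)
  have edge: "b \<le> grid_n k u (-\<delta>) * grid_y k u (-\<delta>)"
    using cells(1) b \<delta> u by (rule opposite_signs_edge_ge)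
  have "b \<le> - (grid_n (Suc k) \<delta> u * grid_y (Suc k) \<delta> u)"
    using cells(2) b \<delta> u by (rule same_signs_edge_ge)
  then have edge': "b \<le> grid_n k u v' * grid_y k u v'"
    using grid_n_Suc[OF \<delta>_eq] grid_y_Suc[OF \<delta>_eq] by simp
  have linear: "grid_n k u x = (u * q k + sigma (Suc k)) + x * (- q (Suc k))"
    "grid_y k u x = (u * D k - tau (Suc k)) + x * D (Suc k)" for x
    by (simp_all add: grid_n_def grid_y_def)
  have "- q (Suc k) * D (Suc k) \<le> 0" using q_pos[of "Suc k"] D_pos[of "Suc k"] by simp
  from concave_product_ge_on_closed_segment[OF this segment
      edge'[unfolded linear] edge[unfolded linear]]
  show ?thesis unfolding linear .
qed

lemma exists_sign_change:
  assumes cells: "\<And>k. k\<^sub>0 \<le> k \<Longrightarrow> cell_ge b k" and start: "coord n m (Suc k\<^sub>0) * coord n m k\<^sub>0 < 0"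
  shows "\<exists>k\<ge>k\<^sub>0. coord n m (Suc k) * coord n m k < 0 \<and>
    0 < coord n m (Suc k) * coord n m (Suc (Suc k))"
proof (rule ccontr)
  assume no_change: "\<not> ?thesis"
  have opposite: "coord n m (Suc k) * coord n m k < 0" if "k\<^sub>0 \<le> k" for k
    using that
  proof (induction k rule: dec_induct)
    case (step k)
    then have "\<not> 0 < coord n m (Suc k) * coord n m (Suc (Suc k))" using no_change by blast
    moreover have "coord n m (Suc k) * coord n m (Suc (Suc k)) \<noteq> 0"
      by (simp add: coord_nonzero del: coord.simps)
    ultimately show ?case unfolding mult.commute[of "coord n m (Suc (Suc k))"] by linarith
  qed (rule start)
  have "real k \<le> 2 * \<bar>of_int n\<bar>" if "k\<^sub>0 \<le> k" for k
  proof -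
    have "real k \<le> q k" by (rule q_ge_index)
    also have "\<dots> \<le> \<bar>grid_n k (of_int (coord n m (Suc k))) (of_int (coord n m k))\<bar>"
      using cells[OF that] of_int_sgn_mult(1,2)[OF coord_nonzero]
        of_int_sgn_mult(4)[OF coord_nonzero opposite[OF that]] by (rule opposite_signs_grid_n_ge)
    also have "\<dots> = 2 * \<bar>of_int n\<bar>" by (simp add: grid_n_coord abs_mult power_abs)
    finally show ?thesis .
  qed
  from this[of "max k\<^sub>0 (nat \<lceil>2 * \<bar>real_of_int n\<bar>\<rceil> + 1)"] show False by linarith
qed

lemma grid_point_ge:
  assumes cells: "\<And>k. k\<^sub>0 \<le> k \<Longrightarrow> cell_ge b k" and b: "0 < b"
    and n: "b / grid_y k\<^sub>0 1 1 \<le> 2 * \<bar>of_int n\<bar>"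
  shows "b \<le> (2 * \<bar>of_int n\<bar>) * (2 * \<bar>of_int n * \<alpha> - of_int m - gamma_ss a \<alpha>\<bar>)"
proof -
  let ?u = "\<lambda>k. real_of_int (coord n m k)"
  have abs_eqs: "\<bar>grid_n k (?u (Suc k)) (?u k)\<bar> = 2 * \<bar>of_int n\<bar>"
    "\<bar>grid_y k (?u (Suc k)) (?u k)\<bar> = 2 * \<bar>of_int n * \<alpha> - of_int m - gamma_ss a \<alpha>\<bar>" for k
    unfolding grid_n_coord grid_y_coord abs_mult by (simp_all add: power_abs)
  note signs = of_int_sgn_mult[OF coord_nonzero]
  have "coord n m (Suc k\<^sub>0) * coord n m k\<^sub>0 \<noteq> 0" by (simp add: coord_nonzero del: coord.simps)
  then consider (same) "0 < coord n m (Suc k\<^sub>0) * coord n m k\<^sub>0"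
    | (opposite) "coord n m (Suc k\<^sub>0) * coord n m k\<^sub>0 < 0"
    by linarith
  then show ?thesis
  proof cases
    case same
    have y_pos: "0 < grid_y k\<^sub>0 1 1" using cells[OF order_refl] b by (rule grid_y_vertex_pos)
    have "b = b / grid_y k\<^sub>0 1 1 * grid_y k\<^sub>0 1 1" using y_pos by simp
    also have "\<dots> \<le> (2 * \<bar>of_int n\<bar>) * \<bar>grid_y k\<^sub>0 (?u (Suc k\<^sub>0)) (?u k\<^sub>0)\<bar>"
      using n y_pos same_signs_grid_y_ge[OF signs(1,2) signs(3)[OF same]] by (intro mult_mono) auto
    finally show ?thesis unfolding abs_eqs .
  next
    case opposite
    then obtain k where k: "k\<^sub>0 \<le> k" and before: "coord n m (Suc k) * coord n m k < 0"
      and after: "0 < coord n m (Suc k) * coord n m (Suc (Suc k))"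
      using exists_sign_change[OF cells] by blast
    have "b \<le> grid_n k (?u (Suc k)) (?u k) * grid_y k (?u (Suc k)) (?u k)"
      using cells[OF k] cells[OF le_SucI[OF k]] b signs(1,2) signs(4)[OF before] signs(3)[OF after]
        real_coord_Suc_Suc by (rule sign_change_grid_product_ge)
    also have "\<dots> \<le> \<bar>grid_n k (?u (Suc k)) (?u k)\<bar> * \<bar>grid_y k (?u (Suc k)) (?u k)\<bar>"
      unfolding abs_mult[symmetric] by (rule abs_ge_self)
    finally show ?thesis unfolding abs_eqs .
  qed
qed

lemma inhom_const_ge_of_cells:
  assumes "\<forall>\<^sub>F k in sequentially. cell_ge b k" and b: "0 < b"
  shows "ereal (b / 4) \<le> inhom_const \<alpha> (gamma_ss a \<alpha>)"
proof -
  obtain k\<^sub>0 where cells: "\<And>k. k\<^sub>0 \<le> k \<Longrightarrow> cell_ge b k"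
    using assms(1) unfolding eventually_sequentially by blast
  show ?thesis
  proof (rule inhom_const_ge)
    fix n m :: int
    assume "\<lceil>b / grid_y k\<^sub>0 1 1\<rceil> \<le> \<bar>n\<bar>"
    then have "b / grid_y k\<^sub>0 1 1 \<le> 2 * \<bar>of_int n\<bar>" by linarith
    from grid_point_ge[OF cells b this, of m]
    show "b / 4 \<le> of_int \<bar>n\<bar> * \<bar>of_int n * \<alpha> - of_int m - gamma_ss a \<alpha>\<bar>" by simp
  qed
qed

end

section \<open>The four vertex inequalities\<close>

text \<open>\<open>\<theta>\<close> is the continued fraction \<open>[0; r, r, \<dots>]\<close>, and \<open>tail_sup = \<theta> + \<theta>\<^sup>2 + \<dots>\<close> the value of \<open>T\<close>
  when all partial quotients equal \<open>r\<close>.\<close>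

locale constant_tail =
  fixes r \<theta> :: real
  assumes r_ge_3: "3 \<le> r" and \<theta>_pos: "0 < \<theta>" and \<theta>_eq: "\<theta> * (r + \<theta>) = 1"
begin

definition tail_sup :: real where
  "tail_sup = \<theta> / (1 - \<theta>)"

definition tail_factor :: real where
  "tail_factor = 1 - 2 * \<theta>^2 - \<theta>^3"

definition vertex_const :: real where
  "vertex_const = (1 - 2 / r) * tail_factor"

lemma \<theta>_sq_le: "\<theta>^2 \<le> 1 - 3 * \<theta>"
proof -
  have "\<theta> * 3 \<le> \<theta> * r" using r_ge_3 \<theta>_pos by simp
  then show ?thesis using \<theta>_eq by (simp add: algebra_simps power2_eq_square)
qed

lemma \<theta>_less_third: "\<theta> < 1/3"
  using \<theta>_sq_le zero_less_power[OF \<theta>_pos, of 2] by linarith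

lemma \<theta>_le_inverse: "\<theta> \<le> 1 / r"
proof -
  have "\<theta> * r \<le> \<theta> * (r + \<theta>)" using \<theta>_pos by simp
  also have "\<dots> = 1" by (rule \<theta>_eq)
  finally show ?thesis using r_ge_3 by (simp add: field_simps)
qed

lemma inverse_r_mult: "1 / r * ((1 - \<theta>) * (1 + \<theta>)) = \<theta>"
proof -
  have "(1 - \<theta>) * (1 + \<theta>) = r * \<theta>" using \<theta>_eq by (simp add: algebra_simps)
  then show ?thesis using r_ge_3 by simp
qed

lemma tail_sup_mult: "tail_sup * (1 - \<theta>) = \<theta>"
  using \<theta>_less_third by (simp add: tail_sup_def)

lemma tail_sup_fixpoint: "tail_sup = \<theta> * (1 + tail_sup)"
  using tail_sup_mult by (simp add: algebra_simps)

lemma tail_sup_mult_inverse: "tail_sup * (r + \<theta>) = 1 + tail_sup"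
  using tail_sup_fixpoint \<theta>_eq by (metis mult.assoc mult.commute mult.right_neutral)

lemma tail_sup_bounds: "0 < tail_sup" "tail_sup < 1/2"
  using \<theta>_less_third \<theta>_pos by (auto simp: tail_sup_def field_simps)

lemma tail_factor_eq_mult: "tail_factor = (1 - \<theta> - \<theta>^2) * (1 + \<theta>)"
  by (simp add: tail_factor_def algebra_simps power2_eq_square power3_eq_cube)

lemma tail_factor_bounds: "0 < tail_factor" "tail_factor \<le> 1"
proof -
  have "0 < 1 - \<theta> - \<theta>^2" using \<theta>_sq_le \<theta>_pos by linarith
  then show "0 < tail_factor" unfolding tail_factor_eq_mult using \<theta>_pos by simp
  show "tail_factor \<le> 1"
    using zero_le_power[of \<theta> 2] zero_le_power[of \<theta> 3] \<theta>_pos unfolding tail_factor_def by linarith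
qed

lemma one_minus_inverse_bounds:
  "0 < 1 - 2 / r" "0 < 1 - 1 / (r - 1)" "0 < 1 - 1 / r" "1 / (r - 1) \<le> 1 / 2"
  using r_ge_3 by (auto simp: field_simps)

lemma one_minus_inverse_mult: "(1 - 1 / (r - 1)) * (1 - 1 / r) = 1 - 2 / r"
  using r_ge_3 by (simp add: field_simps)

lemma vertex_const_pos: "0 < vertex_const"
  unfolding vertex_const_def using tail_factor_bounds(1) one_minus_inverse_bounds(1) by simp

lemma vertex_const_le_one_minus: "vertex_const \<le> 1 - 2 / r"
  unfolding vertex_const_def using tail_factor_bounds(2) one_minus_inverse_bounds(1)
  by (simp add: mult_left_le)

lemma vertex_const_ge: "1 - 2 / r - 2 / r^2 + 3 / r^3 \<le> vertex_const"
proof -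
  define u where "u = 1 / r"
  have u: "0 < u" "2 * u \<le> 1" "\<theta> \<le> u"
    using r_ge_3 \<theta>_le_inverse by (auto simp: u_def field_simps)
  have "1 - 2 * u - 2 * u^2 + 3 * u^3 \<le> 1 - 2 * u - 2 * u^2 + 3 * u^3 + 2 * u^4" by simp
  also have "\<dots> = (1 - 2 * u) * (1 - 2 * u^2 - u^3)"
    by (simp add: algebra_simps power2_eq_square power3_eq_cube power4_eq_xxxx)
  also have "\<dots> \<le> (1 - 2 * u) * tail_factor"
    unfolding tail_factor_def using u \<theta>_pos
    by (intro mult_left_mono diff_mono order_refl power_mono) auto
  finally show ?thesis by (simp add: vertex_const_def u_def power_divide)
qed

lemma vertex_const_le_constant_tail: "vertex_const \<le> 1 - \<theta> - tail_sup"
proof -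
  have "vertex_const * (1 - \<theta>) =
      ((1 - \<theta>) * (1 + \<theta>) - 2 * (1 / r * ((1 - \<theta>) * (1 + \<theta>)))) * (1 - \<theta> - \<theta>^2)"
    unfolding vertex_const_def tail_factor_eq_mult
    by (simp add: algebra_simps add_divide_distrib diff_divide_distrib power2_eq_square)
  also have "\<dots> = 1 - 3 * \<theta> + \<theta>^2 - \<theta>^2 * (1 - 3 * \<theta> - \<theta>^2)"
    unfolding inverse_r_mult by (simp add: algebra_simps power2_eq_square)
  also have "\<dots> \<le> 1 - 3 * \<theta> + \<theta>^2" using \<theta>_sq_le by simp
  also have "\<dots> = (1 - \<theta> - tail_sup) * (1 - \<theta>)"
    using tail_sup_mult by (simp add: algebra_simps power2_eq_square)
  finally show ?thesis by (rule mult_right_le_imp_le) (use \<theta>_less_third in simp)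
qed

lemma tail_factor_complement: "(1 - tail_factor) * (r + \<theta>) = tail_sup + tail_factor * (1 / r)"
proof -
  have "(tail_sup + tail_factor * (1 / r)) * (1 - \<theta>) =
      tail_sup * (1 - \<theta>) + (1 - \<theta> - \<theta>^2) * (1 / r * ((1 - \<theta>) * (1 + \<theta>)))"
    unfolding tail_factor_eq_mult
    by (simp add: algebra_simps add_divide_distrib diff_divide_distrib power2_eq_square)
  also have "\<dots> = (2 * \<theta> + \<theta>^2) * (1 - \<theta>)"
    unfolding inverse_r_mult tail_sup_mult by (simp add: algebra_simps power2_eq_square)
  finally have "tail_sup + tail_factor * (1 / r) = (2 * \<theta> + \<theta>^2) * (\<theta> * (r + \<theta>))"
    using \<theta>_less_third \<theta>_eq by simp
  also have "\<dots> = (1 - tail_factor) * (r + \<theta>)"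
    by (simp add: tail_factor_def algebra_simps power2_eq_square power3_eq_cube)
  finally show ?thesis by simp
qed

subsection \<open>Partial quotients with their parity corrections\<close>

definition admissible_digit :: "real \<Rightarrow> real \<Rightarrow> bool" where
  "admissible_digit x l \<longleftrightarrow> l \<in> {0, 1} \<and> r - 1 + l \<le> x"

lemma admissible_digit_cases [consumes 1, case_names even odd]:
  assumes "admissible_digit x l"
  obtains "l = 0" "r - 1 \<le> x" | "l = 1" "r \<le> x"
  using assms by (auto simp: admissible_digit_def)

lemma admissible_digit_pos: "admissible_digit x l \<Longrightarrow> 0 \<le> y \<Longrightarrow> 0 < x + y"
  using r_ge_3 by (auto simp: admissible_digit_def)

lemma admissible_digit_inverse_le:
  assumes "admissible_digit x l" "0 \<le> y"
  shows "1 / (x + y) \<le> 1 / (r - 1)" "1 / (x + y) \<le> 1 / 2" "l / (x + y) \<le> 1 / r"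
proof -
  show le: "1 / (x + y) \<le> 1 / (r - 1)"
    using assms r_ge_3 by (auto simp: admissible_digit_def intro!: divide_left_mono)
  then show "1 / (x + y) \<le> 1 / 2" using one_minus_inverse_bounds(4) by linarith
  show "l / (x + y) \<le> 1 / r"
    using assms r_ge_3 by (auto simp: admissible_digit_def intro!: divide_left_mono)
qed

subsection \<open>Tails\<close>

definition tail_bounds :: "real \<Rightarrow> real \<Rightarrow> bool" where
  "tail_bounds \<psi> T \<longleftrightarrow> 0 \<le> \<psi> \<and> 0 \<le> T \<and> T \<le> tail_sup \<and> T \<le> \<psi> * (1 + tail_sup)"

lemma tail_sup_diff_le:
  assumes "tail_bounds \<psi> T" "0 \<le> m" "m \<le> 1 + tail_sup"
  shows "T - tail_sup \<le> m * (\<psi> - \<theta>)"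
proof (cases "\<theta> \<le> \<psi>")
  case True
  then have "0 \<le> m * (\<psi> - \<theta>)" using assms by simp
  then show ?thesis using assms(1) unfolding tail_bounds_def by linarith
next
  case False
  have "T - tail_sup \<le> (1 + tail_sup) * (\<psi> - \<theta>)"
    using assms(1) tail_sup_fixpoint by (simp add: tail_bounds_def algebra_simps)
  also have "\<dots> \<le> m * (\<psi> - \<theta>)" using False assms by (intro mult_right_mono_neg) auto
  finally show ?thesis .
qed

lemma tail_bounds_step:
  assumes digit: "admissible_digit x l" and tail: "tail_bounds \<psi> T"
  shows "tail_bounds (1 / (x + \<psi>)) ((l + T) / (x + \<psi>))"
proof -
  have \<psi>: "0 \<le> \<psi>" and T: "0 \<le> T" "T \<le> tail_sup" and l: "0 \<le> l" "l \<le> 1"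
    using tail digit by (auto simp: tail_bounds_def admissible_digit_def)
  have x: "0 < x + \<psi>" using admissible_digit_pos[OF digit \<psi>] .
  have "l + T \<le> tail_sup * (x + \<psi>)"
    using digit
  proof (cases rule: admissible_digit_cases)
    case even
    have "tail_sup * 1 \<le> tail_sup * (x + \<psi>)"
      using even tail_sup_bounds \<psi> r_ge_3 by (intro mult_left_mono) auto
    then show ?thesis using even T by simp
  next
    case odd
    have "T - tail_sup \<le> tail_sup * (\<psi> - \<theta>)"
      using tail_sup_diff_le[OF tail, of tail_sup] tail_sup_bounds by simp
    then have "1 + T \<le> tail_sup * (r + \<psi>)" using tail_sup_mult_inverse by (simp add: algebra_simps)
    also have "\<dots> \<le> tail_sup * (x + \<psi>)" using odd tail_sup_bounds by simp
    finally show ?thesis using odd by simp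
  qed
  moreover have "(l + T) / (x + \<psi>) \<le> (1 + tail_sup) / (x + \<psi>)"
    using l T x by (intro divide_right_mono) auto
  ultimately show ?thesis using l T x by (simp add: tail_bounds_def pos_divide_le_eq)
qed

lemma ratio_add_tail_le:
  assumes digit: "admissible_digit x l" and tail: "tail_bounds \<psi> T"
  shows "1 / (x + \<psi>) + (l + T) / (x + \<psi>) \<le> \<theta> + tail_sup"
proof -
  define S where "S = \<theta> + tail_sup"
  have S: "0 < S" "S \<le> 1" "S \<le> 1 + tail_sup" "S * (r + \<theta>) = 2 + tail_sup"
    using tail_sup_bounds \<theta>_pos \<theta>_less_third \<theta>_eq tail_sup_mult_inverse
    by (auto simp: S_def distrib_right)
  have \<psi>: "0 \<le> \<psi>" and T: "T \<le> tail_sup" using tail by (auto simp: tail_bounds_def)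
  have "1 + l + T \<le> S * (x + \<psi>)"
    using digit
  proof (cases rule: admissible_digit_cases)
    case even
    have "(1 - \<theta>) * (S * (1 + \<theta>)) = (1 + \<theta>) * (\<theta> * (1 - \<theta>) + tail_sup * (1 - \<theta>))"
      by (simp add: S_def algebra_simps)
    also have "\<dots> = 2 * \<theta> + \<theta>^2 - \<theta>^3"
      unfolding tail_sup_mult by (simp add: algebra_simps power2_eq_square power3_eq_cube)
    also have "\<dots> \<le> (1 - \<theta>) * 1"
      unfolding mult_1_right using \<theta>_sq_le zero_less_power[OF \<theta>_pos, of 3] by linarith
    finally have "S * (1 + \<theta>) \<le> 1"
      by (rule mult_left_le_imp_le) (use \<theta>_less_third in simp)
    moreover have "S * (r + \<theta>) - S * (1 + \<theta>) = S * (r - 1)" by (simp add: algebra_simps)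
    ultimately have "1 + T \<le> S * (r - 1)" using S(4) T by linarith
    also have "\<dots> \<le> S * (x + \<psi>)" using even S \<psi> by (intro mult_left_mono) auto
    finally show ?thesis using even by simp
  next
    case odd
    have "T - tail_sup \<le> S * (\<psi> - \<theta>)" using tail_sup_diff_le[OF tail, of S] S by simp
    moreover have "S * (r + \<theta>) + S * (\<psi> - \<theta>) = S * (r + \<psi>)" by (simp add: algebra_simps)
    ultimately have "2 + T \<le> S * (r + \<psi>)" using S(4) by linarith
    also have "\<dots> \<le> S * (x + \<psi>)" using odd S by (intro mult_left_mono) auto
    finally show ?thesis using odd by simp
  qed
  then have "(1 + l + T) / (x + \<psi>) \<le> S"
    using admissible_digit_pos[OF digit \<psi>] by (simp add: pos_divide_le_eq)
  then show ?thesis by (simp add: S_def add_divide_distrib)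
qed

lemma tail_factor_mult_le:
  assumes digit: "admissible_digit x l" and tail: "tail_bounds \<psi> T"
  shows "tail_factor * (1 + 1 / (x + \<psi>) / r) \<le> 1 + 1 / (x + \<psi>) - (l + T) / (x + \<psi>)"
proof -
  have \<psi>: "0 \<le> \<psi>" and T: "T \<le> 1/2" using tail tail_sup_bounds by (auto simp: tail_bounds_def)
  have x: "0 < x + \<psi>" using admissible_digit_pos[OF digit \<psi>] .
  from digit show ?thesis
  proof (cases rule: admissible_digit_cases)
    case even
    have "tail_factor * (1 + 1 / (x + \<psi>) / r) \<le> 1 + 1 / (x + \<psi>) / r"
      using tail_factor_bounds x r_ge_3 by (intro mult_left_le_one_le) auto
    also have "\<dots> \<le> 1 + (1 - T) / (x + \<psi>)"
    proof -
      have "1 / r \<le> 1/2" using r_ge_3 by simp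
      then have "1 / r \<le> 1 - T" using T by linarith
      from divide_right_mono[OF this, of "x + \<psi>"] show ?thesis using x by (simp add: mult.commute)
    qed
    finally show ?thesis using even by (simp add: diff_divide_distrib)
  next
    case odd
    have "T - tail_sup \<le> (1 - tail_factor) * (\<psi> - \<theta>)"
      using tail_sup_diff_le[OF tail, of "1 - tail_factor"] tail_factor_bounds tail_sup_bounds
      by simp
    also have "\<dots> \<le> (1 - tail_factor) * ((x + \<psi>) - (r + \<theta>))"
      using odd tail_factor_bounds by (intro mult_left_mono) auto
    also have "\<dots> = (1 - tail_factor) * (x + \<psi>) - (tail_sup + tail_factor * (1 / r))"
      unfolding tail_factor_complement[symmetric] by (rule right_diff_distrib)
    finally have "(T + tail_factor * (1 / r)) / (x + \<psi>) \<le> 1 - tail_factor"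
      using x by (simp add: pos_divide_le_eq)
    then show ?thesis using odd by (simp add: add_divide_distrib algebra_simps)
  qed
qed

definition tail_estimates :: "real \<Rightarrow> real \<Rightarrow> bool" where
  "tail_estimates \<psi> T \<longleftrightarrow> 0 \<le> \<psi> \<and> \<psi> \<le> 1 / (r - 1) \<and> 0 \<le> T \<and> \<psi> + T \<le> \<theta> + tail_sup \<and>
     2 * T \<le> \<psi> + 2 / r \<and> tail_factor * (1 + \<psi> / r) \<le> 1 + \<psi> - T"

lemma tail_estimates_step:
  assumes digit: "admissible_digit x l" and tail: "tail_bounds \<psi> T"
  shows "tail_estimates (1 / (x + \<psi>)) ((l + T) / (x + \<psi>))"
proof -
  have \<psi>: "0 \<le> \<psi>" and T: "0 \<le> T" "T \<le> 1/2" and l: "0 \<le> l"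
    using tail digit tail_sup_bounds by (auto simp: tail_bounds_def admissible_digit_def)
  have x: "0 < x + \<psi>" using admissible_digit_pos[OF digit \<psi>] .
  have "2 * ((l + T) / (x + \<psi>)) = 2 * (l / (x + \<psi>)) + (2 * T) / (x + \<psi>)"
    by (simp add: add_divide_distrib)
  also have "\<dots> \<le> 2 * (1 / r) + 1 / (x + \<psi>)"
    using admissible_digit_inverse_le(3)[OF digit \<psi>] T x
    by (intro add_mono mult_left_mono divide_right_mono) auto
  finally have "2 * ((l + T) / (x + \<psi>)) \<le> 1 / (x + \<psi>) + 2 / r" by simp
  then show ?thesis
    using admissible_digit_inverse_le(1)[OF digit \<psi>] ratio_add_tail_le[OF digit tail]
      tail_factor_mult_le[OF digit tail] T x l unfolding tail_estimates_def by simp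
qed

subsection \<open>Heads\<close>

definition head_bounds :: "real \<Rightarrow> real \<Rightarrow> bool" where
  "head_bounds \<phi> s \<longleftrightarrow>
     0 \<le> \<phi> \<and> \<phi> \<le> 1/2 \<and> \<bar>s\<bar> \<le> 1/2 \<and> - \<phi> / (r - 1) \<le> s \<and> 4 * s \<le> 5 * \<phi>"

context
  fixes x l \<phi> s :: real
  assumes digit: "admissible_digit x l" and \<phi>_nonneg: "0 \<le> \<phi>"
begin

lemma head_step_abs_le: "\<bar>(l - s) / (x + \<phi>)\<bar> \<le> 1/3 + \<bar>s\<bar> / 2"
proof -
  have pos: "0 < x + \<phi>" "0 \<le> l"
    using digit admissible_digit_pos[OF digit \<phi>_nonneg] by (auto simp: admissible_digit_def)
  have "\<bar>(l - s) / (x + \<phi>)\<bar> = \<bar>l - s\<bar> / (x + \<phi>)" using pos by simp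
  also have "\<dots> \<le> (l + \<bar>s\<bar>) / (x + \<phi>)" using pos by (intro divide_right_mono) auto
  also have "\<dots> = l / (x + \<phi>) + \<bar>s\<bar> * (1 / (x + \<phi>))" by (simp add: add_divide_distrib)
  also have "\<dots> \<le> 1 / r + \<bar>s\<bar> * (1/2)"
    using admissible_digit_inverse_le[OF digit \<phi>_nonneg] by (intro add_mono mult_left_mono) auto
  also have "\<dots> \<le> 1/3 + \<bar>s\<bar> / 2" using r_ge_3 by (simp add: field_simps)
  finally show ?thesis .
qed

lemma head_step_ge:
  assumes "s \<le> b" "0 \<le> b"
  shows "- (1 / (x + \<phi>)) * b \<le> (l - s) / (x + \<phi>)"
proof -
  have "- b \<le> l - s" using assms digit by (auto simp: admissible_digit_def)
  from divide_right_mono[OF this] show ?thesis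
    using admissible_digit_pos[OF digit \<phi>_nonneg] by (simp add: less_imp_le)
qed

lemma head_step_le_inverse:
  assumes "- (1 / (r - 1)) \<le> s"
  shows "(l - s) / (x + \<phi>) \<le> 1 / (r - 1)"
proof -
  have "(l - s) / (x + \<phi>) \<le> (l + 1 / (r - 1)) / (r - 1 + l)"
    using assms digit \<phi>_nonneg r_ge_3 by (intro frac_le) (auto simp: admissible_digit_def)
  also from digit have "\<dots> \<le> 1 / (r - 1)"
  proof (cases rule: admissible_digit_cases)
    case even
    have "1 / (r - 1) / (r - 1) \<le> 1 / (r - 1) / 1" using r_ge_3 by (intro divide_left_mono) auto
    then show ?thesis using even by simp
  next
    case odd
    then show ?thesis using r_ge_3 by (simp add: field_simps)
  qed
  finally show ?thesis .
qed

lemma head_step_le_ratio: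
  assumes "- (1/4) \<le> s"
  shows "4 * ((l - s) / (x + \<phi>)) \<le> 5 * (1 / (x + \<phi>))"
proof -
  have "4 * (l - s) \<le> 5" using assms digit by (auto simp: admissible_digit_def)
  from divide_right_mono[OF this] show ?thesis
    using admissible_digit_pos[OF digit \<phi>_nonneg] by (simp add: less_imp_le)
qed

end

definition head_estimates :: "real \<Rightarrow> real \<Rightarrow> bool" where
  "head_estimates \<phi> s \<longleftrightarrow> 0 \<le> \<phi> \<and> \<phi> \<le> 1/2 \<and> - \<phi> \<le> 2 * s \<and> 2 * s \<le> \<phi> + 2 / r \<and> \<phi> - s \<le> 2 / r \<and>
     (\<phi> + s \<le> 1 / (r - 1) \<or> \<phi> \<le> 1 / r \<and> \<phi> + s \<le> 2 / r)"

lemma head_diff_le: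
  assumes digit: "admissible_digit x l" and head: "head_bounds \<phi> s"
  shows "1 / (x + \<phi>) - (l - s) / (x + \<phi>) \<le> 2 / r"
proof -
  have \<phi>: "0 \<le> \<phi>" "\<phi> \<le> 1/2" and s: "s \<le> 1/2" "s \<le> 5/4 * \<phi>"
    using head by (auto simp: head_bounds_def)
  have x: "0 < x + \<phi>" using admissible_digit_pos[OF digit \<phi>(1)] .
  have "r * (1 - l + s) \<le> 2 * (x + \<phi>)"
    using digit
  proof (cases rule: admissible_digit_cases)
    case even
    have "r * s \<le> 5/4 * (r * \<phi>)" using mult_left_mono[OF s(2), of r] r_ge_3 by simp
    moreover have "(5/4 * r - 2) * \<phi> \<le> (5/4 * r - 2) * (1/2)"
      using \<phi> r_ge_3 by (intro mult_left_mono) auto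
    then have "5/4 * (r * \<phi>) - 2 * \<phi> \<le> 5/8 * r - 1" by (simp add: algebra_simps)
    ultimately have "r + r * s \<le> 2 * r - 2 + 2 * \<phi>" using r_ge_3 by linarith
    then show ?thesis using even by (simp add: distrib_left)
  next
    case odd
    have "r * s \<le> r * 1" using s r_ge_3 by (intro mult_left_mono) auto
    also have "\<dots> \<le> 2 * (x + \<phi>)" using odd \<phi> r_ge_3 by simp
    finally show ?thesis using odd by simp
  qed
  then have "(1 - l + s) / (x + \<phi>) \<le> 2 / r" using x r_ge_3 by (simp add: field_simps)
  then show ?thesis by (simp add: diff_divide_distrib add_divide_distrib)
qed

lemma head_sum_le:
  assumes digit: "admissible_digit x l" and head: "head_bounds \<phi> s"
  shows "1 / (x + \<phi>) + (l - s) / (x + \<phi>) \<le> 1 / (r - 1) \<or>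
    1 / (x + \<phi>) \<le> 1 / r \<and> 1 / (x + \<phi>) + (l - s) / (x + \<phi>) \<le> 2 / r"
proof -
  have \<phi>: "0 \<le> \<phi>" and s: "1 - s \<le> 1 + \<phi> / (r - 1)" using head by (auto simp: head_bounds_def)
  have x: "0 < x + \<phi>" using admissible_digit_pos[OF digit \<phi>] .
  have sum: "1 / (x + \<phi>) + (l - s) / (x + \<phi>) = (1 + l - s) / (x + \<phi>)"
    by (simp add: add_divide_distrib diff_divide_distrib)
  from digit show ?thesis
  proof (cases rule: admissible_digit_cases)
    case even
    have "1 - s \<le> (r - 1 + \<phi>) / (r - 1)" using s r_ge_3 by (simp add: add_divide_distrib)
    also have "\<dots> \<le> (x + \<phi>) / (r - 1)" using even r_ge_3 by (intro divide_right_mono) auto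
    finally have "(1 - s) / (x + \<phi>) \<le> 1 / (r - 1)"
      using x r_ge_3 by (simp add: pos_divide_le_eq mult.commute)
    then show ?thesis unfolding sum using even by simp
  next
    case odd
    have "r / (r - 1) * \<phi> \<le> 2 * \<phi>"
      using \<phi> r_ge_3 by (intro mult_right_mono) (auto simp: field_simps)
    moreover have "r * (2 - s) \<le> r * (2 + \<phi> / (r - 1))"
      using s r_ge_3 by (intro mult_left_mono) auto
    ultimately have "r * (2 - s) \<le> 2 * (x + \<phi>)" using odd by (simp add: distrib_left)
    then have "(2 - s) / (x + \<phi>) \<le> 2 / r" using x r_ge_3 by (simp add: field_simps)
    then show ?thesis
      unfolding sum using odd admissible_digit_inverse_le(3)[OF digit \<phi>] by simp
  qed
qed

lemma head_estimates_step:
  assumes digit: "admissible_digit x l" and head: "head_bounds \<phi> s"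
  shows "head_estimates (1 / (x + \<phi>)) ((l - s) / (x + \<phi>))"
proof -
  have \<phi>: "0 \<le> \<phi>" and s: "\<bar>s\<bar> \<le> 1/2" and l: "0 \<le> l"
    using head digit by (auto simp: head_bounds_def admissible_digit_def)
  have x: "0 < x + \<phi>" using admissible_digit_pos[OF digit \<phi>] .
  have "- 1 \<le> 2 * (l - s)" using s l by (simp add: abs_le_iff)
  from divide_right_mono[OF this, of "x + \<phi>"]
  have ge: "- (1 / (x + \<phi>)) \<le> 2 * ((l - s) / (x + \<phi>))" using x by simp
  have "2 * ((l - s) / (x + \<phi>)) = 2 * (l / (x + \<phi>)) + (- 2 * s) / (x + \<phi>)"
    by (simp add: diff_divide_distrib)
  also have "\<dots> \<le> 2 * (1 / r) + 1 / (x + \<phi>)"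
    using admissible_digit_inverse_le(3)[OF digit \<phi>] s x
    by (intro add_mono mult_left_mono divide_right_mono) auto
  finally have "2 * ((l - s) / (x + \<phi>)) \<le> 1 / (x + \<phi>) + 2 / r" by simp
  with ge show ?thesis
    using admissible_digit_inverse_le(2)[OF digit \<phi>] head_diff_le[OF digit head]
      head_sum_le[OF digit head] x unfolding head_estimates_def by simp
qed

subsection \<open>Vertices\<close>

context
  fixes \<phi> s \<psi> T :: real
  assumes head: "head_estimates \<phi> s" and tail: "tail_estimates \<psi> T"
begin

lemma head_tail_bounds: "0 \<le> \<phi>" "\<phi> \<le> 1/2" "0 \<le> \<psi>" "\<psi> \<le> 1/2" "0 \<le> T" "0 \<le> \<phi> * \<psi>"
  using head tail one_minus_inverse_bounds(4) by (auto simp: head_estimates_def tail_estimates_def)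

lemma mult_le_half: "\<phi> * \<psi> \<le> \<phi> / 2" "\<phi> * \<psi> \<le> \<psi> / 2"
  using mult_left_mono[of \<psi> "1/2" \<phi>] mult_right_mono[of \<phi> "1/2" \<psi>] head_tail_bounds by auto

lemma vertex_const_le_factors:
  assumes "1 - 1 / (r - 1) \<le> v" "1 - 1 / r + \<phi> * \<psi> \<le> w"
  shows "vertex_const * (1 + \<phi> * \<psi>) \<le> v * w"
proof -
  have "0 \<le> (1 / r) * (\<phi> * \<psi>)" using r_ge_3 head_tail_bounds by simp
  then have w: "(1 - 1 / r) * (1 + \<phi> * \<psi>) \<le> w" using assms(2) by (simp add: algebra_simps)
  have pos: "0 \<le> (1 - 1 / r) * (1 + \<phi> * \<psi>)"
    using one_minus_inverse_bounds(3) head_tail_bounds by simp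
  have "vertex_const * (1 + \<phi> * \<psi>) \<le> (1 - 2 / r) * (1 + \<phi> * \<psi>)"
    using vertex_const_le_one_minus head_tail_bounds by (intro mult_right_mono) auto
  also have "\<dots> = (1 - 1 / (r - 1)) * ((1 - 1 / r) * (1 + \<phi> * \<psi>))"
    unfolding one_minus_inverse_mult[symmetric] by (rule mult.assoc)
  also have "\<dots> \<le> v * w" using assms(1) w pos one_minus_inverse_bounds(2) by (intro mult_mono) auto
  finally show ?thesis .
qed

lemma vertex_const_le_opposite_pos: "vertex_const * (1 + \<phi> * \<psi>) \<le> (1 + \<phi> + s) * (1 - \<psi> - T)"
proof -
  have "vertex_const \<le> 1 - \<psi> - T"
    using vertex_const_le_constant_tail tail unfolding tail_estimates_def by linarith
  moreover have "1 + \<phi> * \<psi> \<le> 1 + \<phi> + s"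
    using head mult_le_half(1) unfolding head_estimates_def by linarith
  ultimately have "vertex_const * (1 + \<phi> * \<psi>) \<le> (1 - \<psi> - T) * (1 + \<phi> + s)"
    using vertex_const_pos head_tail_bounds by (intro mult_mono) auto
  then show ?thesis by (simp add: mult.commute)
qed

lemma vertex_const_le_opposite_neg: "vertex_const * (1 + \<phi> * \<psi>) \<le> (1 + \<phi> - s) * (1 - \<psi> + T)"
proof -
  have "vertex_const * (1 + \<phi> * \<psi>) \<le> (1 - \<psi> + T) * (1 + \<phi> - s)"
  proof (rule vertex_const_le_factors)
    show "1 - 1 / (r - 1) \<le> 1 - \<psi> + T" using tail unfolding tail_estimates_def by linarith
    show "1 - 1 / r + \<phi> * \<psi> \<le> 1 + \<phi> - s"
      using head mult_le_half(1) unfolding head_estimates_def by linarith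
  qed
  then show ?thesis by (simp add: mult.commute)
qed

lemma vertex_const_le_same_pos: "vertex_const * (1 + \<phi> * \<psi>) \<le> (1 - \<phi> - s) * (1 + \<psi> - T)"
proof -
  consider (even) "\<phi> + s \<le> 1 / (r - 1)" | (odd) "\<phi> \<le> 1 / r" "\<phi> + s \<le> 2 / r"
    using head unfolding head_estimates_def by blast
  then show ?thesis
  proof cases
    case even
    show ?thesis
    proof (rule vertex_const_le_factors)
      show "1 - 1 / (r - 1) \<le> 1 - \<phi> - s" using even by linarith
      show "1 - 1 / r + \<phi> * \<psi> \<le> 1 + \<psi> - T"
        using tail mult_le_half(2) unfolding tail_estimates_def by linarith
    qed
  next
    case odd
    have "\<phi> * \<psi> \<le> \<psi> / r" using mult_right_mono[OF odd(1), of \<psi>] head_tail_bounds by simp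
    then have "tail_factor * (1 + \<phi> * \<psi>) \<le> tail_factor * (1 + \<psi> / r)"
      using tail_factor_bounds by (intro mult_left_mono) auto
    also have "\<dots> \<le> 1 + \<psi> - T" using tail unfolding tail_estimates_def by blast
    finally have "(1 - 2 / r) * (tail_factor * (1 + \<phi> * \<psi>)) \<le> (1 - \<phi> - s) * (1 + \<psi> - T)"
      using odd(2) one_minus_inverse_bounds(1) tail_factor_bounds(1) head_tail_bounds
      by (intro mult_mono) auto
    then show ?thesis by (simp add: vertex_const_def mult.assoc)
  qed
qed

lemma vertex_const_le_same_neg: "vertex_const * (1 + \<phi> * \<psi>) \<le> (1 - \<phi> + s) * (1 + \<psi> + T)"
proof -
  have "vertex_const \<le> 1 - \<phi> + s"
    using vertex_const_le_one_minus head unfolding head_estimates_def by linarith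
  moreover have "1 + \<phi> * \<psi> \<le> 1 + \<psi> + T" using mult_le_half(2) head_tail_bounds by linarith
  ultimately show ?thesis
    using vertex_const_pos head_tail_bounds by (intro mult_mono) auto
qed

end

end

section \<open>Continued fractions with large partial quotients\<close>

locale large_partial_quotients = irrational_cf \<alpha> a + constant_tail r \<theta>
  for \<alpha> a r \<theta> +
  fixes K :: nat
  assumes admissible: "K \<le> i \<Longrightarrow> admissible_digit (A i) (parity i)"
begin

definition q_ratio :: "nat \<Rightarrow> real" where
  "q_ratio k = q k / q (Suc k)"

definition sigma_ratio :: "nat \<Rightarrow> real" where
  "sigma_ratio k = sigma (Suc k) / q (Suc k)"

definition D_ratio :: "nat \<Rightarrow> real" where
  "D_ratio k = D (Suc k) / D k"

definition tau_ratio :: "nat \<Rightarrow> real" where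
  "tau_ratio k = tau (Suc k) / D k"

lemma q_ratio_nonneg: "0 \<le> q_ratio k"
  using q_pos[of k] q_pos[of "Suc k"] by (simp add: q_ratio_def)

lemma
  shows q_ratio_Suc: "q_ratio (Suc k) = 1 / (A (Suc (Suc k)) + q_ratio k)"
    and sigma_ratio_Suc:
      "sigma_ratio (Suc k) = (parity (Suc (Suc k)) - sigma_ratio k) / (A (Suc (Suc k)) + q_ratio k)"
proof -
  have Q: "q (Suc k) \<noteq> 0" using q_pos[of "Suc k"] by linarith
  have q: "q (Suc (Suc k)) = q (Suc k) * (A (Suc (Suc k)) + q_ratio k)"
    using Q by (simp add: q_ratio_def distrib_left)
  then show "q_ratio (Suc k) = 1 / (A (Suc (Suc k)) + q_ratio k)"
    unfolding q_ratio_def[of "Suc k"] q using Q by simp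
  have \<sigma>: "sigma (Suc (Suc k)) = q (Suc k) * (parity (Suc (Suc k)) - sigma_ratio k)"
    using Q unfolding sigma.simps(2)[of "Suc k"] sigma_ratio_def
    by (simp add: right_diff_distrib del: sigma.simps)
  show "sigma_ratio (Suc k) =
      (parity (Suc (Suc k)) - sigma_ratio k) / (A (Suc (Suc k)) + q_ratio k)"
    unfolding sigma_ratio_def[of "Suc k"] q \<sigma> using Q by simp
qed

lemma D_ratio_eq: "D_ratio k = 1 / (A (Suc (Suc k)) + D_ratio (Suc k))"
proof -
  have "A (Suc (Suc k)) + D_ratio (Suc k) = D k / D (Suc k)"
    using D_pos[of "Suc k"] by (simp add: D_ratio_def D_simps field_simps)
  then show ?thesis by (simp add: D_ratio_def)
qed

subsection \<open>Tails\<close>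

definition tau_upto :: "nat \<Rightarrow> nat \<Rightarrow> real" where
  "tau_upto n k = (\<Sum>j<n. parity (Suc (j + k)) * D (j + k))"

lemma tau_upto_tendsto: "(\<lambda>n. tau_upto n k) \<longlonglongrightarrow> tau k"
  unfolding tau_upto_def tau_def by (rule summable_LIMSEQ[OF tau_summable])

lemma tau_upto_ratio_Suc:
  "tau_upto (Suc n) (Suc k) / D k =
     (parity (Suc (Suc k)) + tau_upto n (Suc (Suc k)) / D (Suc k)) /
     (A (Suc (Suc k)) + D_ratio (Suc k))"
proof -
  have "tau_upto (Suc n) (Suc k) / D k =
      D_ratio k * (parity (Suc (Suc k)) + tau_upto n (Suc (Suc k)) / D (Suc k))"
    unfolding tau_upto_def sum.lessThan_Suc_shift D_ratio_def
    using D_pos[of "Suc k"] by (simp add: add_divide_distrib distrib_left)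
  then show ?thesis unfolding D_ratio_eq[of k] by simp
qed

lemma tau_ratio_eq:
  "tau_ratio k = (parity (Suc (Suc k)) + tau_ratio (Suc k)) / (A (Suc (Suc k)) + D_ratio (Suc k))"
proof -
  have "tau_ratio k = D_ratio k * (parity (Suc (Suc k)) + tau_ratio (Suc k))"
    using D_pos[of "Suc k"] D_pos[of k]
    by (simp add: tau_ratio_def D_ratio_def tau_rec[of "Suc k"] field_simps)
  then show ?thesis unfolding D_ratio_eq[of k] by simp
qed

lemma tail_bounds_upto: "K \<le> k \<Longrightarrow> tail_bounds (D_ratio k) (tau_upto n (Suc k) / D k)"
proof (induction n arbitrary: k)
  case 0
  have "0 \<le> D_ratio k" using D_pos[of k] D_pos[of "Suc k"] by (simp add: D_ratio_def)
  then show ?case using tail_sup_bounds by (simp add: tail_bounds_def tau_upto_def)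
next
  case (Suc n)
  then show ?case
    unfolding tau_upto_ratio_Suc D_ratio_eq[of k]
    by (intro tail_bounds_step admissible) auto
qed

lemma tail_bounds_ratio:
  assumes "K \<le> k"
  shows "tail_bounds (D_ratio k) (tau_ratio k)"
proof -
  have "(\<lambda>n. tau_upto n (Suc k) / D k) \<longlonglongrightarrow> tau_ratio k"
    unfolding tau_ratio_def using tau_upto_tendsto D_pos[of k] by (intro tendsto_divide) auto
  then show ?thesis
    using tail_bounds_upto[OF assms] unfolding tail_bounds_def
    by (auto intro: Lim_bounded Lim_bounded2)
qed

lemma tail_estimates_ratio: "K \<le> k \<Longrightarrow> tail_estimates (D_ratio k) (tau_ratio k)"
  unfolding D_ratio_eq[of k] tau_ratio_eq[of k]
  by (intro tail_estimates_step admissible tail_bounds_ratio) auto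

subsection \<open>Heads\<close>

lemma admissible_Suc_Suc: "K \<le> k \<Longrightarrow> admissible_digit (A (Suc (Suc k))) (parity (Suc (Suc k)))"
  by (rule admissible) simp

lemmas head_step_premises = admissible_Suc_Suc q_ratio_nonneg

lemma q_ratio_Suc_le: "K \<le> k \<Longrightarrow> q_ratio (Suc k) \<le> 1 / (r - 1)"
  unfolding q_ratio_Suc by (rule admissible_digit_inverse_le(1)[OF head_step_premises])

lemma sigma_ratio_abs_le: "\<bar>sigma_ratio (K + j)\<bar> \<le> 2/3 + \<bar>sigma_ratio K\<bar> / 2^j"
proof (induction j)
  case (Suc j)
  have "\<bar>sigma_ratio (Suc (K + j))\<bar> \<le> 1/3 + \<bar>sigma_ratio (K + j)\<bar> / 2"
    unfolding sigma_ratio_Suc by (intro head_step_abs_le head_step_premises) simp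
  also have "\<dots> \<le> 2/3 + \<bar>sigma_ratio K\<bar> / 2 ^ Suc j" using Suc.IH by simp
  finally show ?case by simp
qed simp

lemma sigma_ratio_eventually_le_1: "\<forall>\<^sub>F k in sequentially. \<bar>sigma_ratio k\<bar> \<le> 1"
proof -
  have "(\<lambda>j. 2/3 + \<bar>sigma_ratio K\<bar> / 2^j) \<longlonglongrightarrow> 2/3 + 0"
    by (intro tendsto_intros LIMSEQ_divide_realpow_zero) auto
  then have "\<forall>\<^sub>F j in sequentially. 2/3 + \<bar>sigma_ratio K\<bar> / 2^j < 1"
    by (rule order_tendstoD) simp
  then have "\<forall>\<^sub>F j in sequentially. \<bar>sigma_ratio (j + K)\<bar> \<le> 1"
    by eventually_elim (metis sigma_ratio_abs_le add.commute less_imp_le order.trans)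
  then show ?thesis by (subst (asm) eventually_sequentially_seg)
qed

lemma sigma_ratio_eventually_ge_inverse: "\<forall>\<^sub>F k in sequentially. - (1 / (r - 1)) \<le> sigma_ratio k"
  using sigma_ratio_eventually_le_1
proof (rule eventually_Suc_step)
  fix k assume k: "K \<le> k" and "\<bar>sigma_ratio k\<bar> \<le> 1"
  then have "- q_ratio (Suc k) * 1 \<le> sigma_ratio (Suc k)"
    unfolding q_ratio_Suc sigma_ratio_Suc by (intro head_step_ge head_step_premises) auto
  then show "- (1 / (r - 1)) \<le> sigma_ratio (Suc k)" using q_ratio_Suc_le[OF k] by linarith
qed

lemma sigma_ratio_eventually_le_inverse: "\<forall>\<^sub>F k in sequentially. sigma_ratio k \<le> 1 / (r - 1)"
  using sigma_ratio_eventually_ge_inverse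
proof (rule eventually_Suc_step)
  fix k assume "K \<le> k" "- (1 / (r - 1)) \<le> sigma_ratio k"
  then show "sigma_ratio (Suc k) \<le> 1 / (r - 1)"
    unfolding sigma_ratio_Suc by (intro head_step_le_inverse head_step_premises)
qed

lemma sigma_ratio_eventually_ge_q_ratio:
  "\<forall>\<^sub>F k in sequentially. - q_ratio k / (r - 1) \<le> sigma_ratio k"
  using sigma_ratio_eventually_le_inverse
proof (rule eventually_Suc_step)
  fix k assume "K \<le> k" "sigma_ratio k \<le> 1 / (r - 1)"
  then have "- q_ratio (Suc k) * (1 / (r - 1)) \<le> sigma_ratio (Suc k)"
    unfolding q_ratio_Suc sigma_ratio_Suc using r_ge_3
    by (intro head_step_ge head_step_premises) auto
  then show "- q_ratio (Suc k) / (r - 1) \<le> sigma_ratio (Suc k)" by simp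
qed

lemma q_ratio_eventually_le_half: "\<forall>\<^sub>F k in sequentially. q_ratio k \<le> 1/2"
proof (rule eventually_Suc_step[of "\<lambda>_. True"])
  fix k assume "K \<le> k"
  then show "q_ratio (Suc k) \<le> 1/2"
    using q_ratio_Suc_le[of k] one_minus_inverse_bounds(4) by linarith
qed simp

lemma sigma_ratio_eventually_le_q_ratio: "\<forall>\<^sub>F k in sequentially. 4 * sigma_ratio k \<le> 5 * q_ratio k"
  using eventually_conj[OF sigma_ratio_eventually_ge_q_ratio q_ratio_eventually_le_half]
proof (rule eventually_Suc_step)
  fix k assume k: "K \<le> k" and "- q_ratio k / (r - 1) \<le> sigma_ratio k \<and> q_ratio k \<le> 1/2"
  moreover from this have "q_ratio k * (1 / (r - 1)) \<le> 1/2 * (1/2)"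
    using one_minus_inverse_bounds(4) r_ge_3 by (intro mult_mono) auto
  ultimately have "- (1/4) \<le> sigma_ratio k" by simp
  then show "4 * sigma_ratio (Suc k) \<le> 5 * q_ratio (Suc k)"
    unfolding q_ratio_Suc sigma_ratio_Suc using k by (intro head_step_le_ratio head_step_premises)
qed

lemma head_bounds_eventually: "\<forall>\<^sub>F k in sequentially. head_bounds (q_ratio k) (sigma_ratio k)"
  using sigma_ratio_eventually_ge_inverse sigma_ratio_eventually_le_inverse
    sigma_ratio_eventually_ge_q_ratio sigma_ratio_eventually_le_q_ratio q_ratio_eventually_le_half
proof eventually_elim
  case (elim k)
  then have "\<bar>sigma_ratio k\<bar> \<le> 1/2" using one_minus_inverse_bounds(4) by linarith
  then show ?case using elim q_ratio_nonneg[of k] by (simp add: head_bounds_def)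
qed

lemma head_estimates_eventually:
  "\<forall>\<^sub>F k in sequentially. head_estimates (q_ratio k) (sigma_ratio k)"
  using head_bounds_eventually
proof (rule eventually_Suc_step)
  fix k assume "K \<le> k" "head_bounds (q_ratio k) (sigma_ratio k)"
  then show "head_estimates (q_ratio (Suc k)) (sigma_ratio (Suc k))"
    unfolding q_ratio_Suc sigma_ratio_Suc by (intro head_estimates_step admissible_Suc_Suc)
qed

subsection \<open>Cells\<close>

lemma
  shows grid_n_eq_ratio: "grid_n k u v = q (Suc k) * (u * q_ratio k - v + sigma_ratio k)"
    and grid_y_eq_ratio: "grid_y k u v = D k * (u + v * D_ratio k - tau_ratio k)"
proof -
  have "q (Suc k) \<noteq> 0" "D k \<noteq> 0" using q_pos[of "Suc k"] D_pos[of k] by auto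
  then show "grid_n k u v = q (Suc k) * (u * q_ratio k - v + sigma_ratio k)"
    and "grid_y k u v = D k * (u + v * D_ratio k - tau_ratio k)"
    unfolding grid_n_def grid_y_def q_ratio_def sigma_ratio_def D_ratio_def tau_ratio_def
    by (simp_all add: algebra_simps del: sigma.simps)
qed

lemma le_product_of_ratios:
  assumes "b * (1 + q_ratio k * D_ratio k) \<le> x * y"
  shows "b \<le> (q (Suc k) * x) * (D k * y)"
proof -
  have QD: "0 < q (Suc k)" "0 < D k" using q_pos D_pos by auto
  have "q (Suc k) * D k * (1 + q_ratio k * D_ratio k) = 1"
    using q_D_determinant[of k] QD unfolding q_ratio_def D_ratio_def by (simp add: field_simps)
  then have "b = q (Suc k) * D k * (b * (1 + q_ratio k * D_ratio k))" by (simp add: ac_simps)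
  also have "\<dots> \<le> q (Suc k) * D k * (x * y)" using assms QD by (intro mult_left_mono) auto
  finally show ?thesis by (simp add: ac_simps)
qed

lemma cell_ge_vertex_const:
  assumes head: "head_estimates (q_ratio k) (sigma_ratio k)"
    and tail: "tail_estimates (D_ratio k) (tau_ratio k)"
  shows "cell_ge vertex_const k"
  unfolding cell_ge_def
proof (intro ballI conjI)
  fix \<delta> :: real assume \<delta>: "\<delta> \<in> {1, -1}"
  let ?\<phi> = "q_ratio k" and ?s = "sigma_ratio k" and ?\<psi> = "D_ratio k" and ?T = "tau_ratio k"
  have "?s \<le> 1" "- 1 \<le> ?s" "0 \<le> 1 - ?\<phi> - ?s" "0 \<le> 1 - ?\<phi> + ?s"
    using head one_minus_inverse_bounds unfolding head_estimates_def by linarith+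
  then have signs: "?\<phi> \<le> 1 + ?\<phi> + \<delta> * ?s" "0 \<le> 1 - ?\<phi> - \<delta> * ?s" using \<delta> by auto
  have n: "\<delta> * grid_n k \<delta> (-\<delta>) = q (Suc k) * (1 + ?\<phi> + \<delta> * ?s)"
    "- (\<delta> * grid_n k \<delta> \<delta>) = q (Suc k) * (1 - ?\<phi> - \<delta> * ?s)"
    using \<delta> by (auto simp: grid_n_eq_ratio algebra_simps)
  have y: "\<delta> * grid_y k \<delta> (-\<delta>) = D k * (1 - ?\<psi> - \<delta> * ?T)"
    "\<delta> * grid_y k \<delta> \<delta> = D k * (1 + ?\<psi> - \<delta> * ?T)"
    using \<delta> by (auto simp: grid_y_eq_ratio algebra_simps)
  have "q k = q (Suc k) * ?\<phi>" using q_pos[of "Suc k"] by (simp add: q_ratio_def)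
  then show "q k \<le> \<delta> * grid_n k \<delta> (-\<delta>)"
    unfolding n using signs(1) q_pos[of "Suc k"] by (simp add: mult_left_mono)
  have "0 \<le> - (\<delta> * grid_n k \<delta> \<delta>)"
    unfolding n using signs(2) q_pos[of "Suc k"] by (intro mult_nonneg_nonneg) auto
  then show "\<delta> * grid_n k \<delta> \<delta> \<le> 0" by simp
  have "vertex_const \<le> (\<delta> * grid_n k \<delta> (-\<delta>)) * (\<delta> * grid_y k \<delta> (-\<delta>))"
    unfolding n y using \<delta> vertex_const_le_opposite_pos[OF head tail]
      vertex_const_le_opposite_neg[OF head tail]
    by (intro le_product_of_ratios) auto
  then show "vertex_const \<le> grid_n k \<delta> (-\<delta>) * grid_y k \<delta> (-\<delta>)" using \<delta> by auto
  have "vertex_const \<le> (- (\<delta> * grid_n k \<delta> \<delta>)) * (\<delta> * grid_y k \<delta> \<delta>)"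
    unfolding n y using \<delta> vertex_const_le_same_pos[OF head tail]
      vertex_const_le_same_neg[OF head tail]
    by (intro le_product_of_ratios) auto
  then show "vertex_const \<le> - (grid_n k \<delta> \<delta> * grid_y k \<delta> \<delta>)" using \<delta> by auto
qed

lemma cell_ge_eventually: "\<forall>\<^sub>F k in sequentially. cell_ge vertex_const k"
  using head_estimates_eventually eventually_ge_at_top[of K]
  by eventually_elim (intro cell_ge_vertex_const tail_estimates_ratio)

end

section \<open>The lower bound\<close>

lemma R_star_ge_3:
  assumes "2 \<le> R"
  shows "3 \<le> R_star R"
  using assms by (cases "R = 2") (auto simp: R_star_def)

lemma R_star_parity_corr_le:
  assumes "R \<le> a i"
  shows "R_star R - 1 + parity_corr a i \<le> a i"
  using assms by (cases "R = a i") (auto simp: R_star_def parity_corr_def)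

lemma theta1_pos: "0 < theta1 R"
proof -
  have "of_int (R_star R) \<le> sqrt (of_int (R_star R) ^ 2)" by simp
  also have "\<dots> < sqrt (of_int (R_star R) ^ 2 + 4)" by (subst real_sqrt_less_iff) simp
  finally show ?thesis by (simp add: theta1_def)
qed

lemma theta1_fixpoint: "theta1 R * (of_int (R_star R) + theta1 R) = 1"
proof -
  define r where "r = real_of_int (R_star R)"
  have "theta1 R * (r + theta1 R) = ((sqrt (r^2 + 4))^2 - r^2) / 4"
    unfolding theta1_def r_def[symmetric] by (simp add: field_simps power2_eq_square)
  then show ?thesis by (simp add: r_def)
qed

theorem theorem5:
  fixes \<alpha> :: real and a :: "nat \<Rightarrow> int" and R :: int
  assumes "\<alpha> \<notin> \<rat>"
    and "regular_cf_expansion a \<alpha>"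
    and "liminf (\<lambda>i. ereal (of_int (a i))) = ereal (of_int R)"
    and "2 \<le> R"
  shows "inhom_const \<alpha> (gamma_ss a \<alpha>)
           \<ge> ereal (1/4 * (1 - 2 / of_int (R_star R)) * (1 - 2 * theta1 R ^ 2 - theta1 R ^ 3))
       \<and> 1/4 * (1 - 2 / of_int (R_star R)) * (1 - 2 * theta1 R ^ 2 - theta1 R ^ 3)
           \<ge> 1/4 * (1 - 2 / of_int (R_star R) - 2 / of_int (R_star R) ^ 2 + 3 / of_int (R_star R) ^ 3)"
proof -
  interpret constant_tail "of_int (R_star R)" "theta1 R"
    using R_star_ge_3[OF assms(4)] by unfold_locales (simp_all add: theta1_pos theta1_fixpoint)
  obtain K where K: "\<And>i. K \<le> i \<Longrightarrow> R \<le> a i"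
    using eventually_ge_of_Liminf_ge[of R sequentially a] assms(3)
    by (auto simp: eventually_sequentially)
  have "admissible_digit (of_int (a i)) (of_int (parity_corr a i))" if "K \<le> i" for i
  proof -
    have "real_of_int (R_star R - 1 + parity_corr a i) \<le> of_int (a i)"
      unfolding of_int_le_iff using R_star_parity_corr_le K that by blast
    then show ?thesis by (simp add: admissible_digit_def parity_corr_def)
  qed
  then interpret large_partial_quotients \<alpha> a "of_int (R_star R)" "theta1 R" K
    using assms(1,2) by unfold_locales
  have "ereal (vertex_const / 4) \<le> inhom_const \<alpha> (gamma_ss a \<alpha>)"
    using cell_ge_eventually vertex_const_pos by (rule inhom_const_ge_of_cells)
  then show ?thesis using vertex_const_ge by (simp add: vertex_const_def tail_factor_def)
qed

end
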